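(* Let $G$ be a non-trivial finite group with identity $e$. Let $\mathcal{N}\subseteq\tilde G^*$ be the set of relations of the group $\mathcal{G}(\partial\mathcal{C}(G))$ defined in the context, and for $k\ge 0$ put $\mathcal{N}_{2k}=\mathcal{N}\cap\tilde G^{2k}$ and $\mathcal{V}_{2k}=\{v\in\tilde G^{2k}:\ g\cdot v\in\mathcal{N}_{2k}\ \text{for all } g\in G\}$. Then for every $k\ge 0$ $$\mathcal{N}_{2(k+1)}=\bigcup_{\substack{x,y\in G,\ v\in\mathcal{V}_{2k}\\ xy^{-1}\hat v=e}}\bigl[(x)(y)^{-1}v\bigr]_{c}.$$
   Context: $\tilde G=G\sqcup G^{-1}$, where $G^{-1}=\{(g)^{-1}:g\in G\}$ is a set of formal inverses; the letter of $\tilde G$ corresponding to $g\in G$ is written $(g)$, so $(g^{-1})$ (the letter for the group inverse of $g$) is different from the formal inverse letter $(g)^{-1}$. $\tilde G^{2k}$ is the set of words of length $2k$ over $\tilde G$. For $u=(u_1)^{e_1}\cdots(u_n)^{e_n}\in\tilde G^*$ with $e_i\in\{1,-1\}$, $\hat u=u_1^{e_1}\cdots u_n^{e_n}$ is the product evaluated in $G$. $[u]_c=\{xy: yx=u\}$ is the set of cyclic shifts of $u$. The Cayley machine $\mathcal{C}(G)$ is the transducer with states $G$, alphabet $G$ and edges $g\xrightarrow{x|gx}gx$ ($g,x\in G$; input $x$, output $gx$). The transducer $\mathcal{C}(G)^{-}$ has states $G$, alphabet $\tilde G$, and is obtained by adding to $\mathcal{C}(G)$, for each edge $g\xrightarrow{x|y}h$,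 the edge $h\xrightarrow{(x)^{-1}|(y)^{-1}}g$; so its edges are $g\xrightarrow{(x)|(gx)}gx$ and $g\xrightarrow{(x)^{-1}|(g)^{-1}}gx^{-1}$. For $g\in G$ and $u\in\tilde G^*$, $g\cdot u\in\tilde G^*$ denotes the output word produced when $\mathcal{C}(G)^{-}$ reads $u$ (from left to right) starting at state $g$, and $L(\mathcal{C}(G)^{-},g)$ is the set of words $u\in\tilde G^*$ that, read as input from $g$, lead back to $g$. $\mathcal{N}$ is the largest subset of $\bigcap_{g\in G}L(\mathcal{C}(G)^{-},g)$ such that $g\cdot u\in\mathcal{N}$ for all $g\in G$, $u\in\mathcal{N}$. (It is the set of words over $\tilde G$ representing the identity of the group $\mathcal{G}(\partial\mathcal{C}(G))$ generated by the dual of $\mathcal{C}(G)$.) *)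

theory Defs
  imports "HOL-Algebra.Group"
begin

text \<open>The letters of \<open>G \<squnion> G\<^sup>-\<^sup>1\<close>: \<open>Pos x\<close> is the letter \<open>(x)\<close> and \<open>Neg x\<close> is the formal
  inverse \<open>(x)\<^sup>-\<^sup>1\<close>, which is not the letter \<open>Pos (inv x)\<close> of the group inverse.\<close>

datatype 'a letter = Pos 'a | Neg 'a

definition letters :: "('a, 'm) monoid_scheme \<Rightarrow> 'a letter set" where
  "letters G = Pos ` carrier G \<union> Neg ` carrier G"

abbreviation words :: "('a, 'm) monoid_scheme \<Rightarrow> 'a letter list set" where
  "words G \<equiv> lists (letters G)"

definition words_of_length :: "('a, 'm) monoid_scheme \<Rightarrow> nat \<Rightarrow> 'a letter list set" where
  "words_of_length G n = {u \<in> words G. length u = n}"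

primrec letter_val :: "('a, 'm) monoid_scheme \<Rightarrow> 'a letter \<Rightarrow> 'a" where
  "letter_val G (Pos x) = x"
| "letter_val G (Neg x) = inv\<^bsub>G\<^esub> x"

primrec word_val :: "('a, 'm) monoid_scheme \<Rightarrow> 'a letter list \<Rightarrow> 'a" where
  "word_val G [] = \<one>\<^bsub>G\<^esub>"
| "word_val G (l # u) = letter_val G l \<otimes>\<^bsub>G\<^esub> word_val G u"

definition cyclic_shifts :: "'b list \<Rightarrow> 'b list set" where
  "cyclic_shifts u = {x @ y |x y. y @ x = u}"


text \<open>A transducer is given by its set of edges \<open>(source, input, output, target)\<close>.\<close>

type_synonym ('s, 'b) transducer = "('s \<times> 'b \<times> 'b \<times> 's) set"

inductive run :: "('s, 'b) transducer \<Rightarrow> 's \<Rightarrow> 'b list \<Rightarrow> 'b list \<Rightarrow> 's \<Rightarrow> bool"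
  for T where
  run_Nil: "run T s [] [] s"
| run_Cons: "(s, a, b, s') \<in> T \<Longrightarrow> run T s' u v t \<Longrightarrow> run T s (a # u) (b # v) t"

definition cayley_machine :: "('a, 'm) monoid_scheme \<Rightarrow> ('a, 'a) transducer" where
  "cayley_machine G = {(g, x, g \<otimes>\<^bsub>G\<^esub> x, g \<otimes>\<^bsub>G\<^esub> x) |g x. g \<in> carrier G \<and> x \<in> carrier G}"

definition add_inverse_edges :: "('s, 'a) transducer \<Rightarrow> ('s, 'a letter) transducer" where
  "add_inverse_edges T =
     {(g, Pos x, Pos y, h) |g x y h. (g, x, y, h) \<in> T} \<union>
     {(h, Neg x, Neg y, g) |g x y h. (g, x, y, h) \<in> T}"

abbreviation cayley_inv :: "('a, 'm) monoid_scheme \<Rightarrow> ('a, 'a letter) transducer" where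
  "cayley_inv G \<equiv> add_inverse_edges (cayley_machine G)"

definition loop_language :: "('a, 'm) monoid_scheme \<Rightarrow> 'a \<Rightarrow> 'a letter list set" where
  "loop_language G g = {u \<in> words G. \<exists>v. run (cayley_inv G) g u v g}"

text \<open>The output word \<open>g \<cdot> u\<close>. It is uniquely determined when \<open>G\<close> is a group, \<open>g \<in> carrier G\<close>
  and \<open>u \<in> words G\<close> (see \<open>run_cayley_inv_ex1\<close> below).\<close>

definition act :: "('a, 'm) monoid_scheme \<Rightarrow> 'a \<Rightarrow> 'a letter list \<Rightarrow> 'a letter list" where
  "act G g u = (THE v. \<exists>h. run (cayley_inv G) g u v h)"

definition stable_relations :: "('a, 'm) monoid_scheme \<Rightarrow> 'a letter list set \<Rightarrow> bool" where
  "stable_relations G M \<longleftrightarrow>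
     M \<subseteq> (\<Inter>g\<in>carrier G. loop_language G g) \<and>
     (\<forall>g\<in>carrier G. \<forall>u\<in>M. act G g u \<in> M)"

text \<open>Such sets are closed under unions, so their union is the largest one (see
  \<open>relations_greatest\<close> below).\<close>

definition relations :: "('a, 'm) monoid_scheme \<Rightarrow> 'a letter list set" where
  "relations G = \<Union>{M. stable_relations G M}"

definition relations_of_length :: "('a, 'm) monoid_scheme \<Rightarrow> nat \<Rightarrow> 'a letter list set" where
  "relations_of_length G n = relations G \<inter> words_of_length G n"

definition pre_relations_of_length :: "('a, 'm) monoid_scheme \<Rightarrow> nat \<Rightarrow> 'a letter list set" where
  "pre_relations_of_length G n =
     {v \<in> words_of_length G n. \<forall>g\<in>carrier G. act G g v \<in> relations_of_length G n}"


lemma relations_greatest: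
  "stable_relations G (relations G)"
  "stable_relations G M \<Longrightarrow> M \<subseteq> relations G"
  unfolding relations_def stable_relations_def by blast+

lemma cayley_inv_Pos_iff:
  "(g, Pos x, b, h) \<in> cayley_inv G \<longleftrightarrow>
     g \<in> carrier G \<and> x \<in> carrier G \<and> b = Pos (g \<otimes>\<^bsub>G\<^esub> x) \<and> h = g \<otimes>\<^bsub>G\<^esub> x"
  by (auto simp: add_inverse_edges_def cayley_machine_def)

lemma (in group) cayley_inv_Neg_iff:
  "(g, Neg x, b, h) \<in> cayley_inv G \<longleftrightarrow>
     g \<in> carrier G \<and> x \<in> carrier G \<and> b = Neg g \<and> h = g \<otimes> inv x"
proof
  assume "(g, Neg x, b, h) \<in> cayley_inv G"
  then show "g \<in> carrier G \<and> x \<in> carrier G \<and> b = Neg g \<and> h = g \<otimes> inv x"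
    by (auto simp: add_inverse_edges_def cayley_machine_def m_assoc)
next
  assume *: "g \<in> carrier G \<and> x \<in> carrier G \<and> b = Neg g \<and> h = g \<otimes> inv x"
  then have "h \<in> carrier G" "g = h \<otimes> x" by (auto simp: m_assoc)
  with * have "(h, x, g, g) \<in> cayley_machine G" by (auto simp: cayley_machine_def)
  with * show "(g, Neg x, b, h) \<in> cayley_inv G" by (auto simp: add_inverse_edges_def)
qed

lemma (in group) run_cayley_inv_ex1:
  assumes "u \<in> words G" "g \<in> carrier G"
  shows "\<exists>!vh. run (cayley_inv G) g u (fst vh) (snd vh)"
  using assms
proof (induction u arbitrary: g rule: lists.induct)
  case Nil
  show ?case by (rule ex1I[of _ "([], g)"]) (auto intro: run_Nil elim: run.cases)
next
  case (Cons l u)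
  have "\<exists>b h. h \<in> carrier G \<and> (g, l, b, h) \<in> cayley_inv G \<and>
          (\<forall>b' h'. (g, l, b', h') \<in> cayley_inv G \<longrightarrow> b' = b \<and> h' = h)"
    using Cons.hyps(1) Cons.prems
    by (cases l) (auto simp: letters_def cayley_inv_Pos_iff cayley_inv_Neg_iff)
  then obtain b h where h: "h \<in> carrier G" "(g, l, b, h) \<in> cayley_inv G"
    and uniq: "\<And>b' h'. (g, l, b', h') \<in> cayley_inv G \<Longrightarrow> b' = b \<and> h' = h" by blast
  from Cons.IH[OF h(1)] obtain v t where vt: "run (cayley_inv G) h u v t"
    and uniq': "\<And>v' t'. run (cayley_inv G) h u v' t' \<Longrightarrow> v' = v \<and> t' = t"
    by (metis fst_conv snd_conv)
  show ?case
  proof (rule ex1I[of _ "(b # v, t)"])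
    show "run (cayley_inv G) g (l # u) (fst (b # v, t)) (snd (b # v, t))"
      using h(2) vt by (simp add: run_Cons)
  next
    fix wt assume "run (cayley_inv G) g (l # u) (fst wt) (snd wt)"
    then show "wt = (b # v, t)"
      by cases (use uniq uniq' in \<open>auto simp: prod_eq_iff\<close>)
  qed
qed

end

theory Submission
  imports Defs
begin

text \<open>
  Reading a word from the state \<open>g\<close> ends in \<open>g \<otimes> word_val G u\<close>, so \<open>relations G\<close> consists of the
  words all of whose images under finite sequences of the maps \<open>act G g\<close> have value \<open>\<one>\<close>.
  Membership in \<open>relations G\<close> is therefore a coinductive statement (\<open>relations_coinduct\<close>), and in
  this way one sees that \<open>relations G\<close> is closed under cyclic shifts and under
  inserting or deleting a prefix \<open>(a)(a)\<^sup>-\<^sup>1\<close>.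

  The identity behind the theorem is
  \<open>g \<cdot> (x)(y)\<^sup>-\<^sup>1v = (gx)(gx)\<^sup>-\<^sup>1(gxy\<^sup>-\<^sup>1 \<cdot> v)\<close>.
  The prefix of the output cancels, and \<open>gxy\<^sup>-\<^sup>1\<close> runs through the whole group together with \<open>g\<close>;
  so \<open>(x)(y)\<^sup>-\<^sup>1v\<close> is a relation exactly when its value is \<open>\<one>\<close> and \<open>h \<cdot> v\<close> is a relation for
  every \<open>h\<close> (\<open>Pos_Neg_relation_iff\<close>).

  What remains is to find a factor \<open>(x)(y)\<^sup>-\<^sup>1\<close> in some cyclic shift of any nonempty relation,
  that is, to exclude nonempty relations whose letters all have the same sign. For positive words
  of length \<open>n\<close>, every map \<open>act G g\<close> is injective, hence permutes the finite set of positive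
  relations of that length; but the last letter of its output is \<open>(g)\<close>, because the run
  returns to \<open>g\<close>. So every positive relation of length \<open>n\<close> would end in \<open>(g)\<close> for each \<open>g\<close>, which
  is impossible in a non-trivial group. For negative words the first letter of the output, \<open>(g)\<^sup>-\<^sup>1\<close>,
  plays the same part.
\<close>

section \<open>Cyclic shifts\<close>

lemma cyclic_shifts_sym: "u \<in> cyclic_shifts v \<Longrightarrow> v \<in> cyclic_shifts u"
  unfolding cyclic_shifts_def by blast

lemma cyclic_shifts_eq_rotate: "cyclic_shifts u = range (\<lambda>n. rotate n u)"
proof (intro equalityI subsetI)
  fix w assume "w \<in> cyclic_shifts u"
  then obtain x y where "w = x @ y" "u = y @ x"
    unfolding cyclic_shifts_def by blast
  then have "w = rotate (length y) u" by (simp add: rotate_append)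
  then show "w \<in> range (\<lambda>n. rotate n u)" by blast
next
  fix w assume "w \<in> range (\<lambda>n. rotate n u)"
  then obtain n where "w = rotate n u" by blast
  then have "w = drop (n mod length u) u @ take (n mod length u) u"
    by (simp add: rotate_drop_take)
  then show "w \<in> cyclic_shifts u"
    unfolding cyclic_shifts_def using append_take_drop_id by blast
qed

lemma cyclic_shifts_trans:
  "u \<in> cyclic_shifts v \<Longrightarrow> v \<in> cyclic_shifts w \<Longrightarrow> u \<in> cyclic_shifts w"
  unfolding cyclic_shifts_eq_rotate by (auto simp: rotate_rotate)

lemma cyclic_shifts_append: "x @ y \<in> cyclic_shifts (y @ x)"
  unfolding cyclic_shifts_def by blast

text \<open>Rotate so that the word starts with a positive letter; the letter before the first negative
  one is then positive.\<close>

lemma mixed_word_cyclic_shift: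
  assumes "Pos a \<in> set w" "Neg b \<in> set w"
  shows "\<exists>x y v. w \<in> cyclic_shifts (Pos x # Neg y # v)"
proof -
  obtain s t where w: "w = s @ Pos a # t"
    using assms(1) by (meson split_list)
  have "Neg b \<in> set (t @ s)" using assms(2) w by auto
  then have "\<exists>l\<in>set (t @ s). \<exists>y. l = Neg y" by blast
  then obtain p l q where p: "t @ s = p @ l # q" "\<exists>y. l = Neg y"
    "\<forall>l\<in>set p. \<not> (\<exists>y. l = Neg y)"
    by (rule split_list_first_propE)
  then obtain y where y: "l = Neg y" by blast
  obtain r m where r: "Pos a # p = r @ [m]"
    by (metis append_butlast_last_id list.distinct(1))
  then have "m \<in> set (Pos a # p)" by simp
  with p(3) obtain x where x: "m = Pos x" by (cases m) auto
  have "w \<in> cyclic_shifts ((Pos a # t) @ s)" unfolding w by (rule cyclic_shifts_append)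
  moreover have "(Pos a # t) @ s = r @ (Pos x # Neg y # q)"
    using p(1) r x y by simp
  ultimately have "w \<in> cyclic_shifts (r @ (Pos x # Neg y # q))" by simp
  then have "w \<in> cyclic_shifts ((Pos x # Neg y # q) @ r)"
    using cyclic_shifts_append cyclic_shifts_trans by blast
  then show ?thesis by auto
qed


text \<open>Applied below to the action on relations of constant sign: an injective self-map of a finite
  set is onto, so a label that \<open>T g\<close> puts on all its values is carried by all of \<open>A\<close>.\<close>

lemma label_of_permutations_unique:
  assumes "finite A" "a \<in> A"
    and "\<And>g. g \<in> C \<Longrightarrow> inj_on (T g) A" "\<And>g. g \<in> C \<Longrightarrow> T g ` A \<subseteq> A"
    and label: "\<And>g u. g \<in> C \<Longrightarrow> u \<in> A \<Longrightarrow> p (T g u) = g"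
    and "g \<in> C" "h \<in> C"
  shows "g = h"
proof -
  have "p a = f" if "f \<in> C" for f
  proof -
    have "T f ` A = A" using assms(1,3,4) that by (simp add: endo_inj_surj)
    then obtain u where "u \<in> A" "a = T f u" using assms(2) by blast
    then show ?thesis using label that by simp
  qed
  then show ?thesis using assms(6,7) by blast
qed

context group
begin

section \<open>The action on words\<close>

lemma letter_val_closed [simp]: "l \<in> letters G \<Longrightarrow> letter_val G l \<in> carrier G"
  by (auto simp: letters_def)

lemma word_val_closed [simp]: "u \<in> words G \<Longrightarrow> word_val G u \<in> carrier G"
  by (induction u) auto

lemma Pos_in_letters [simp]: "Pos x \<in> letters G \<longleftrightarrow> x \<in> carrier G"
  and Neg_in_letters [simp]: "Neg x \<in> letters G \<longleftrightarrow> x \<in> carrier G"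
  by (auto simp: letters_def)

lemma word_val_append:
  "u \<in> words G \<Longrightarrow> v \<in> words G \<Longrightarrow> word_val G (u @ v) = word_val G u \<otimes> word_val G v"
  by (induction u) (auto simp: m_assoc)

lemma act_eqI:
  assumes "run (cayley_inv G) g u v h" "u \<in> words G" "g \<in> carrier G"
  shows "act G g u = v"
proof -
  have "v' = v" if "run (cayley_inv G) g u v' h'" for v' h'
    using run_cayley_inv_ex1[OF assms(2,3)] assms(1) that by (metis fst_conv snd_conv)
  then show ?thesis unfolding act_def using assms(1) by blast
qed

lemma run_act:
  assumes "u \<in> words G" "g \<in> carrier G"
  shows "run (cayley_inv G) g u (act G g u) (g \<otimes> word_val G u)"
proof -
  have "\<exists>v. run (cayley_inv G) g u v (g \<otimes> word_val G u)"
    using assms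
  proof (induction u arbitrary: g)
    case Nil
    then show ?case using run_Nil by (metis r_one word_val.simps(1))
  next
    case (Cons l u)
    have l: "l \<in> letters G" and u: "u \<in> words G" by (fact Cons.hyps)+
    have "\<exists>b. (g, l, b, g \<otimes> letter_val G l) \<in> cayley_inv G"
      using l Cons.prems by (cases l) (auto simp: cayley_inv_Pos_iff cayley_inv_Neg_iff)
    moreover have "g \<otimes> word_val G (l # u) = g \<otimes> letter_val G l \<otimes> word_val G u"
      using l u Cons.prems by (simp add: m_assoc)
    ultimately show ?case
      using Cons.IH[of "g \<otimes> letter_val G l"] l Cons.prems
      by (metis letter_val_closed m_closed run_Cons)
  qed
  then show ?thesis using act_eqI assms by blast
qed

lemma act_Nil [simp]: "g \<in> carrier G \<Longrightarrow> act G g [] = []"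
  by (auto intro: act_eqI run_Nil)

lemma act_Pos [simp]:
  "g \<in> carrier G \<Longrightarrow> x \<in> carrier G \<Longrightarrow> u \<in> words G \<Longrightarrow>
     act G g (Pos x # u) = Pos (g \<otimes> x) # act G (g \<otimes> x) u"
  by (rule act_eqI, rule run_Cons[OF _ run_act]) (auto simp: cayley_inv_Pos_iff)

lemma act_Neg [simp]:
  "g \<in> carrier G \<Longrightarrow> x \<in> carrier G \<Longrightarrow> u \<in> words G \<Longrightarrow>
     act G g (Neg x # u) = Neg g # act G (g \<otimes> inv x) u"
  by (rule act_eqI, rule run_Cons[OF _ run_act]) (auto simp: cayley_inv_Neg_iff)

lemma act_words [simp]: "u \<in> words G \<Longrightarrow> g \<in> carrier G \<Longrightarrow> act G g u \<in> words G"
proof (induction u arbitrary: g)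
  case (Cons l u)
  then show ?case by (cases l) auto
qed simp

lemma length_act [simp]: "u \<in> words G \<Longrightarrow> g \<in> carrier G \<Longrightarrow> length (act G g u) = length u"
proof (induction u arbitrary: g)
  case (Cons l u)
  then show ?case by (cases l) auto
qed simp

lemma act_append:
  "u \<in> words G \<Longrightarrow> v \<in> words G \<Longrightarrow> g \<in> carrier G \<Longrightarrow>
     act G g (u @ v) = act G g u @ act G (g \<otimes> word_val G u) v"
proof (induction u arbitrary: g)
  case (Cons l u)
  then show ?case by (cases l) (auto simp: m_assoc)
qed simp

lemma in_loop_language_iff:
  assumes "g \<in> carrier G"
  shows "u \<in> loop_language G g \<longleftrightarrow> u \<in> words G \<and> word_val G u = \<one>"
proof -
  have "(\<exists>v. run (cayley_inv G) g u v g) \<longleftrightarrow> word_val G u = \<one>" if u: "u \<in> words G"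
  proof
    assume "\<exists>v. run (cayley_inv G) g u v g"
    then have "g = g \<otimes> word_val G u"
      using run_cayley_inv_ex1[OF u assms] run_act[OF u assms] by (metis fst_conv snd_conv)
    then show "word_val G u = \<one>" using u assms
      l_cancel_one'[of g "word_val G u"] by simp
  next
    assume "word_val G u = \<one>"
    then show "\<exists>v. run (cayley_inv G) g u v g" using run_act[OF u assms] assms by auto
  qed
  then show ?thesis unfolding loop_language_def by blast
qed

section \<open>Closure properties of the relations\<close>

lemma relationsD:
  assumes "u \<in> relations G"
  shows "u \<in> words G" "word_val G u = \<one>" "g \<in> carrier G \<Longrightarrow> act G g u \<in> relations G"
proof -
  have sub: "relations G \<subseteq> (\<Inter>g\<in>carrier G. loop_language G g)"
    and closed: "\<forall>g\<in>carrier G. \<forall>u\<in>relations G. act G g u \<in> relations G"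
    using relations_greatest(1)[of G] unfolding stable_relations_def by simp_all
  have "u \<in> loop_language G \<one>" using sub assms one_closed by blast
  then show "u \<in> words G" "word_val G u = \<one>" by (simp_all add: in_loop_language_iff)
  show "act G g u \<in> relations G" if "g \<in> carrier G" using closed assms that by blast
qed

text \<open>As \<open>relations G\<close> is itself stable, a stable set need only be stable up to \<open>relations G\<close>.\<close>

lemma relations_coinduct [consumes 1, case_names words val act]:
  assumes "u \<in> M"
    and "\<And>u. u \<in> M \<Longrightarrow> u \<in> words G" "\<And>u. u \<in> M \<Longrightarrow> word_val G u = \<one>"
    and "\<And>g u. u \<in> M \<Longrightarrow> g \<in> carrier G \<Longrightarrow> act G g u \<in> M \<union> relations G"
  shows "u \<in> relations G"
proof -
  have "stable_relations G (M \<union> relations G)"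
    unfolding stable_relations_def
  proof (intro conjI subsetI INT_I ballI)
    fix w g assume g: "g \<in> carrier G" and w: "w \<in> M \<union> relations G"
    then have "w \<in> words G \<and> word_val G w = \<one>" using assms(2,3) relationsD(1,2) by blast
    then show "w \<in> loop_language G g" using g by (simp add: in_loop_language_iff)
    show "act G g w \<in> M \<union> relations G" using w assms(4)[OF _ g] relationsD(3)[OF _ g] by blast
  qed
  then show ?thesis using relations_greatest(2) assms(1) by blast
qed

text \<open>Reading \<open>v @ u\<close> from \<open>g\<close> is reading \<open>u @ v\<close> from the state reached between the two
  factors, so the images of a cyclic shift are cyclic shifts of images.\<close>

lemma relations_append_commute:
  assumes "u @ v \<in> relations G"
  shows "v @ u \<in> relations G"
proof -
  have "v @ u \<in> {v @ u |u v. u @ v \<in> relations G}" using assms by blast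
  then show ?thesis
  proof (cases rule: relations_coinduct)
    case (words w)
    then obtain u v where w: "w = v @ u" and uv: "u @ v \<in> relations G" by blast
    show ?case using relationsD(1)[OF uv] unfolding w by simp
  next
    case (val w)
    then obtain u v where w: "w = v @ u" and uv: "u @ v \<in> relations G" by blast
    have uw: "u \<in> words G" "v \<in> words G" using relationsD(1)[OF uv] by auto
    then show ?case
      using relationsD(2)[OF uv] inv_comm[of "word_val G u" "word_val G v"]
      unfolding w by (simp add: word_val_append)
  next
    case (act g w)
    then obtain u v where w: "w = v @ u" and uv: "u @ v \<in> relations G" by blast
    have uw: "u \<in> words G" "v \<in> words G" using relationsD(1)[OF uv] by auto
    have "word_val G v \<otimes> word_val G u = \<one>"
      using relationsD(2)[OF uv] uw inv_comm[of "word_val G u" "word_val G v"]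
      by (simp add: word_val_append)
    then have "g \<otimes> word_val G v \<otimes> word_val G u = g"
      using uw act by (simp add: m_assoc)
    then have "act G (g \<otimes> word_val G v) (u @ v) = act G (g \<otimes> word_val G v) u @ act G g v"
      using uw act by (simp add: act_append)
    then have "act G (g \<otimes> word_val G v) u @ act G g v \<in> relations G"
      using relationsD(3)[OF uv, of "g \<otimes> word_val G v"] uw act by simp
    moreover have "act G g w = act G g v @ act G (g \<otimes> word_val G v) u"
      using w uw act by (simp add: act_append)
    ultimately show ?case by blast
  qed
qed

lemma relations_cyclic_shift:
  "u \<in> relations G \<Longrightarrow> w \<in> cyclic_shifts u \<Longrightarrow> w \<in> relations G"
  unfolding cyclic_shifts_def using relations_append_commute by blast

lemma relations_insert_Pos_Neg:
  assumes "v \<in> relations G" "a \<in> carrier G"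
  shows "Pos a # Neg a # v \<in> relations G"
proof -
  have "Pos a # Neg a # v \<in> {Pos a # Neg a # v |a v. a \<in> carrier G \<and> v \<in> relations G}"
    using assms by blast
  then show ?thesis
  proof (cases rule: relations_coinduct)
    case (words w)
    then obtain a v where w: "w = Pos a # Neg a # v" "a \<in> carrier G" "v \<in> relations G" by blast
    then show ?case using relationsD(1)[OF w(3)] by simp
  next
    case (val w)
    then obtain a v where w: "w = Pos a # Neg a # v" "a \<in> carrier G" "v \<in> relations G" by blast
    then show ?case using relationsD(2)[OF w(3)] by simp
  next
    case (act g w)
    then obtain a v where w: "w = Pos a # Neg a # v" "a \<in> carrier G" "v \<in> relations G" by blast
    then have "act G g w = Pos (g \<otimes> a) # Neg (g \<otimes> a) # act G g v"
      using relationsD(1)[OF w(3)] act by (simp add: m_assoc)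
    moreover have "g \<otimes> a \<in> carrier G" "act G g v \<in> relations G"
      using act w relationsD(3) by simp_all
    ultimately show ?case by blast
  qed
qed

lemma relations_delete_Pos_Neg:
  assumes "Pos a # Neg a # v \<in> relations G"
  shows "v \<in> relations G"
proof -
  have "v \<in> {v. \<exists>a. Pos a # Neg a # v \<in> relations G}" using assms by blast
  then show ?thesis
  proof (cases rule: relations_coinduct)
    case (words v)
    then obtain a where a: "Pos a # Neg a # v \<in> relations G" by blast
    show ?case using relationsD(1)[OF a] by simp
  next
    case (val v)
    then obtain a where a: "Pos a # Neg a # v \<in> relations G" by blast
    have "a \<in> carrier G" "v \<in> words G" using relationsD(1)[OF a] by auto
    then show ?case using relationsD(2)[OF a] by (simp add: m_assoc[symmetric])
  next
    case (act g v)
    then obtain a where a: "Pos a # Neg a # v \<in> relations G" by blast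
    have "a \<in> carrier G" "v \<in> words G" using relationsD(1)[OF a] by auto
    then have "act G g (Pos a # Neg a # v) = Pos (g \<otimes> a) # Neg (g \<otimes> a) # act G g v"
      using act by (simp add: m_assoc)
    then have "Pos (g \<otimes> a) # Neg (g \<otimes> a) # act G g v \<in> relations G"
      using relationsD(3)[OF a] act by metis
    then show ?case by blast
  qed
qed

lemma Pos_Neg_relation_iff:
  assumes x: "x \<in> carrier G" and y: "y \<in> carrier G" and v: "v \<in> words G"
  shows "Pos x # Neg y # v \<in> relations G \<longleftrightarrow>
    x \<otimes> inv y \<otimes> word_val G v = \<one> \<and> (\<forall>h\<in>carrier G. act G h v \<in> relations G)"
proof
  assume w: "Pos x # Neg y # v \<in> relations G"
  have "act G h v \<in> relations G" if h: "h \<in> carrier G" for h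
  proof -
    \<comment> \<open>the state from which the prefix \<open>(x)(y)\<^sup>-\<^sup>1\<close> leads to \<open>h\<close>\<close>
    define g where "g = h \<otimes> y \<otimes> inv x"
    have g: "g \<in> carrier G" "g \<otimes> x \<otimes> inv y = h"
      using h x y by (simp_all add: g_def m_assoc)
    then have "Pos (g \<otimes> x) # Neg (g \<otimes> x) # act G h v \<in> relations G"
      using relationsD(3)[OF w g(1)] x y v by simp
    then show ?thesis by (rule relations_delete_Pos_Neg)
  qed
  then show "x \<otimes> inv y \<otimes> word_val G v = \<one> \<and> (\<forall>h\<in>carrier G. act G h v \<in> relations G)"
    using relationsD(2)[OF w] x y v by (simp add: m_assoc)
next
  assume *: "x \<otimes> inv y \<otimes> word_val G v = \<one> \<and> (\<forall>h\<in>carrier G. act G h v \<in> relations G)"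
  have "Pos x # Neg y # v \<in> {Pos x # Neg y # v}" by simp
  then show "Pos x # Neg y # v \<in> relations G"
  proof (cases rule: relations_coinduct)
    case (words w)
    then show ?case using x y v by simp
  next
    case (val w)
    then show ?case using * x y v by (simp add: m_assoc)
  next
    case (act g w)
    then have "act G g w = Pos (g \<otimes> x) # Neg (g \<otimes> x) # act G (g \<otimes> x \<otimes> inv y) v"
      using x y v by simp
    then show ?case using * x y act(2) relations_insert_Pos_Neg by simp
  qed
qed

section \<open>Relations of constant sign\<close>

lemma Pos_words_subset: "lists (Pos ` carrier G) \<subseteq> words G"
  and Neg_words_subset: "lists (Neg ` carrier G) \<subseteq> words G"
  unfolding letters_def by (auto intro!: lists_mono)

lemma Pos_words: "u \<in> lists (Pos ` carrier G) \<Longrightarrow> u \<in> words G"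
  and Neg_words: "u \<in> lists (Neg ` carrier G) \<Longrightarrow> u \<in> words G"
  using Pos_words_subset Neg_words_subset by blast+

lemma act_Pos_word:
  "u \<in> lists (Pos ` carrier G) \<Longrightarrow> g \<in> carrier G \<Longrightarrow> act G g u \<in> lists (Pos ` carrier G)"
proof (induction u arbitrary: g)
  case (Cons l u)
  then obtain x where x: "l = Pos x" "x \<in> carrier G"
    and u: "u \<in> lists (Pos ` carrier G)" by auto
  then show ?case using Cons.IH[of "g \<otimes> x"] Pos_words[OF u] Cons.prems by simp
qed simp

lemma act_Neg_word:
  "u \<in> lists (Neg ` carrier G) \<Longrightarrow> g \<in> carrier G \<Longrightarrow> act G g u \<in> lists (Neg ` carrier G)"
proof (induction u arbitrary: g)
  case (Cons l u)
  then obtain x where x: "l = Neg x" "x \<in> carrier G"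
    and u: "u \<in> lists (Neg ` carrier G)" by auto
  then show ?case using Cons.IH[of "g \<otimes> inv x"] Neg_words[OF u] Cons.prems by simp
qed simp

lemma last_act_Pos_word:
  "u \<in> lists (Pos ` carrier G) \<Longrightarrow> u \<noteq> [] \<Longrightarrow> g \<in> carrier G \<Longrightarrow>
     last (act G g u) = Pos (g \<otimes> word_val G u)"
proof (induction u arbitrary: g)
  case (Cons l u)
  then obtain x where x: "l = Pos x" "x \<in> carrier G" and u: "u \<in> words G"
    using Pos_words by auto
  show ?case
  proof (cases "u = []")
    case False
    then have "act G (g \<otimes> x) u \<noteq> []"
      using u x Cons.prems by (metis length_0_conv length_act m_closed)
    then show ?thesis using Cons False x u by (auto simp: m_assoc)
  qed (use x Cons.prems in auto)
qed simp

lemma hd_act_Neg_word: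
  "u \<in> lists (Neg ` carrier G) \<Longrightarrow> u \<noteq> [] \<Longrightarrow> g \<in> carrier G \<Longrightarrow> hd (act G g u) = Neg g"
proof (induction u)
  case (Cons l u)
  then obtain x where "l = Neg x" "x \<in> carrier G" and "u \<in> lists (Neg ` carrier G)" by auto
  then show ?case using Neg_words[of u] Cons.prems by simp
qed simp

lemma act_inj_Pos_words:
  "u \<in> lists (Pos ` carrier G) \<Longrightarrow> u' \<in> lists (Pos ` carrier G) \<Longrightarrow> g \<in> carrier G \<Longrightarrow>
     act G g u = act G g u' \<Longrightarrow> u = u'"
proof (induction u arbitrary: g u')
  case Nil
  then show ?case using Pos_words by (metis act_Nil length_0_conv length_act)
next
  case (Cons l u)
  from Cons.prems obtain x where x: "l = Pos x" "x \<in> carrier G" by auto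
  have "length u' = length (l # u)"
    using Cons.prems Pos_words by (metis length_act)
  then obtain l' w where w: "u' = l' # w" by (cases u') auto
  with Cons.prems obtain x' where x': "l' = Pos x'" "x' \<in> carrier G" by auto
  have words: "u \<in> lists (Pos ` carrier G)" "w \<in> lists (Pos ` carrier G)"
    using Cons.prems w by auto
  then have "g \<otimes> x = g \<otimes> x'" "act G (g \<otimes> x) u = act G (g \<otimes> x') w"
    using Cons.prems w x x' Pos_words by auto
  then show ?case using Cons.IH[of w "g \<otimes> x"] words Cons.prems x x' w by auto
qed

text \<open>The output of a negative word shows only the states before its letters. The state after the
  last letter, which is missing, is recovered from the value.\<close>

lemma act_inj_Neg_words:
  "u \<in> lists (Neg ` carrier G) \<Longrightarrow> u' \<in> lists (Neg ` carrier G) \<Longrightarrow> g \<in> carrier G \<Longrightarrow>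
     act G g u = act G g u' \<Longrightarrow> word_val G u = word_val G u' \<Longrightarrow> u = u'"
proof (induction u arbitrary: g u')
  case Nil
  then show ?case using Neg_words by (metis act_Nil length_0_conv length_act)
next
  case (Cons l u)
  from Cons.prems obtain x where x: "l = Neg x" "x \<in> carrier G" by auto
  have len: "length u' = length (l # u)"
    using Cons.prems Neg_words by (metis length_act)
  then obtain l' w where w: "u' = l' # w" by (cases u') auto
  with Cons.prems obtain x' where x': "l' = Neg x'" "x' \<in> carrier G" by auto
  have lists: "u \<in> lists (Neg ` carrier G)" "w \<in> lists (Neg ` carrier G)"
    using Cons.prems w by auto
  then have words: "u \<in> words G" "w \<in> words G" by (simp_all add: Neg_words)
  have act: "act G (g \<otimes> inv x) u = act G (g \<otimes> inv x') w"
    using Cons.prems w x x' words by auto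
  have val: "inv x \<otimes> word_val G u = inv x' \<otimes> word_val G w"
    using Cons.prems w x x' by simp
  have inv: "inv x = inv x'"
  proof (cases "u = []")
    case True
    then show ?thesis using val len w x x' by simp
  next
    case False
    moreover from this have "w \<noteq> []" using len w by auto
    ultimately have "Neg (g \<otimes> inv x) = Neg (g \<otimes> inv x')"
      using act hd_act_Neg_word lists Cons.prems x x' by (metis inv_closed m_closed)
    then show ?thesis using Cons.prems x x' by simp
  qed
  then have "x = x'" using x x' by (metis inv_inv)
  then show ?case using Cons.IH[of w "g \<otimes> inv x"] lists words act val Cons.prems x x' w by auto
qed

lemma no_Pos_relations:
  assumes "finite (carrier G)" "carrier G \<noteq> {\<one>}"
    and "u \<in> relations G" "u \<noteq> []"
  shows "u \<notin> lists (Pos ` carrier G)"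
proof
  assume u: "u \<in> lists (Pos ` carrier G)"
  define A where "A = {w \<in> lists (Pos ` carrier G). length w = length u} \<inter> relations G"
  have "finite A" unfolding A_def
    using finite_lists_length_eq[of "Pos ` carrier G" "length u"] assms(1)
    by (simp add: lists_eq_set)
  have "g = h" if "g \<in> carrier G" "h \<in> carrier G" for g h
  proof (rule label_of_permutations_unique[of A u "carrier G" "act G" "\<lambda>w. THE x. last w = Pos x"])
    show "u \<in> A" using u assms(3) by (simp add: A_def)
    show "inj_on (act G g) A" if "g \<in> carrier G" for g
      using that act_inj_Pos_words by (auto simp: A_def inj_on_def)
    show "act G g ` A \<subseteq> A" if "g \<in> carrier G" for g
      using that
      by (simp add: A_def image_subset_iff act_Pos_word relationsD(3) Pos_words)
    show "(THE x. last (act G g w) = Pos x) = g" if "g \<in> carrier G" "w \<in> A" for g w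
    proof -
      have "w \<noteq> []" using that(2) assms(4) by (auto simp: A_def)
      then have "last (act G g w) = Pos g"
        using that last_act_Pos_word[of w g] relationsD(2)[of w] by (auto simp: A_def)
      then show ?thesis by simp
    qed
  qed fact+
  then have "carrier G = {\<one>}" by blast
  then show False using assms(2) by blast
qed

lemma no_Neg_relations:
  assumes "finite (carrier G)" "carrier G \<noteq> {\<one>}"
    and "u \<in> relations G" "u \<noteq> []"
  shows "u \<notin> lists (Neg ` carrier G)"
proof
  assume u: "u \<in> lists (Neg ` carrier G)"
  define A where "A = {w \<in> lists (Neg ` carrier G). length w = length u} \<inter> relations G"
  have "finite A" unfolding A_def
    using finite_lists_length_eq[of "Neg ` carrier G" "length u"] assms(1)
    by (simp add: lists_eq_set)
  have "g = h" if "g \<in> carrier G" "h \<in> carrier G" for g h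
  proof (rule label_of_permutations_unique[of A u "carrier G" "act G" "\<lambda>w. THE x. hd w = Neg x"])
    show "u \<in> A" using u assms(3) by (simp add: A_def)
    show "inj_on (act G g) A" if "g \<in> carrier G" for g
      using that act_inj_Neg_words relationsD(2) by (auto simp: A_def inj_on_def)
    show "act G g ` A \<subseteq> A" if "g \<in> carrier G" for g
      using that
      by (simp add: A_def image_subset_iff act_Neg_word relationsD(3) Neg_words)
    show "(THE x. hd (act G g w) = Neg x) = g" if "g \<in> carrier G" "w \<in> A" for g w
    proof -
      have "w \<noteq> []" using that(2) assms(4) by (auto simp: A_def)
      then have "hd (act G g w) = Neg g"
        using that hd_act_Neg_word[of w g] by (auto simp: A_def)
      then show ?thesis by simp
    qed
  qed fact+
  then have "carrier G = {\<one>}" by blast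
  then show False using assms(2) by blast
qed

section \<open>The recursive description\<close>

lemma relation_cyclic_shift_Pos_Neg:
  assumes "finite (carrier G)" "carrier G \<noteq> {\<one>}"
    and "w \<in> relations G" "w \<noteq> []"
  shows "\<exists>x y v. w \<in> cyclic_shifts (Pos x # Neg y # v)"
proof -
  have w: "set w \<subseteq> letters G" using relationsD(1)[OF assms(3)] by auto
  obtain l where l: "l \<in> set w" "l \<notin> Pos ` carrier G"
    using no_Pos_relations[OF assms] by auto
  obtain m where m: "m \<in> set w" "m \<notin> Neg ` carrier G"
    using no_Neg_relations[OF assms] by auto
  obtain a b where "l = Neg b" "m = Pos a" using l m w unfolding letters_def by blast
  then show ?thesis using mixed_word_cyclic_shift[of a w b] l(1) m(1) by simp
qed

end

theorem proposition12:
  fixes G :: "('a, 'm) monoid_scheme" (structure)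
  assumes "group G" and "finite (carrier G)" and "carrier G \<noteq> {\<one>}"
  shows "\<forall>k::nat. relations_of_length G (2 * (k + 1)) =
    \<Union> {cyclic_shifts (Pos x # Neg y # v) |x y v.
         x \<in> carrier G \<and> y \<in> carrier G \<and> v \<in> pre_relations_of_length G (2 * k) \<and>
         x \<otimes> inv y \<otimes> word_val G v = \<one>}"
proof
  fix k :: nat
  interpret group G by fact
  let ?R = "\<lambda>x y v. x \<in> carrier G \<and> y \<in> carrier G \<and> v \<in> pre_relations_of_length G (2 * k) \<and>
         x \<otimes> inv y \<otimes> word_val G v = \<one>"
  have R_iff: "?R x y v \<longleftrightarrow> Pos x # Neg y # v \<in> relations_of_length G (2 * (k + 1))" for x y v
  proof -
    have "Pos x # Neg y # v \<in> relations_of_length G (2 * (k + 1)) \<longleftrightarrow>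
      x \<in> carrier G \<and> y \<in> carrier G \<and> v \<in> words G \<and> length v = 2 * k \<and>
      Pos x # Neg y # v \<in> relations G"
      by (auto simp: relations_of_length_def words_of_length_def)
    moreover have "v \<in> pre_relations_of_length G (2 * k) \<longleftrightarrow>
      v \<in> words G \<and> length v = 2 * k \<and> (\<forall>g\<in>carrier G. act G g v \<in> relations G)"
      by (simp add: pre_relations_of_length_def relations_of_length_def words_of_length_def
          cong: conj_cong ball_cong)
    ultimately show ?thesis
      using Pos_Neg_relation_iff[of x y v] by blast
  qed
  have shift: "u \<in> relations_of_length G n"
    if "w \<in> relations_of_length G n" "u \<in> cyclic_shifts w" for u w n
  proof -
    have "length u = length w" using that(2) by (auto simp: cyclic_shifts_def)
    then show ?thesis
      using that relations_cyclic_shift relationsD(1)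
      by (auto simp: relations_of_length_def words_of_length_def)
  qed
  show "relations_of_length G (2 * (k + 1)) =
    \<Union> {cyclic_shifts (Pos x # Neg y # v) |x y v. ?R x y v}"
  proof (intro equalityI subsetI)
    fix w assume w: "w \<in> relations_of_length G (2 * (k + 1))"
    then have "w \<in> relations G" "w \<noteq> []"
      by (auto simp: relations_of_length_def words_of_length_def)
    then obtain x y v where xyv: "w \<in> cyclic_shifts (Pos x # Neg y # v)"
      using relation_cyclic_shift_Pos_Neg assms by blast
    then have "?R x y v" using shift[OF w] cyclic_shifts_sym R_iff by blast
    then show "w \<in> \<Union> {cyclic_shifts (Pos x # Neg y # v) |x y v. ?R x y v}"
      using xyv by blast
  next
    fix w assume "w \<in> \<Union> {cyclic_shifts (Pos x # Neg y # v) |x y v. ?R x y v}"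
    then obtain x y v where "?R x y v" "w \<in> cyclic_shifts (Pos x # Neg y # v)" by blast
    then show "w \<in> relations_of_length G (2 * (k + 1))" using shift R_iff by blast
  qed
qed

end
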